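(* Let $(\mathbf{X},d)$ be a Polish space and let $\mathbb{L}:C_b(\mathbf{X})\to\mathbb{R}$ be a convex Varadhan functional which is $\sigma$-continuous. Then there is a lower semicontinuous function $\mathbb{J}:\mathcal{P}(\mathbf{X})\to[0,\infty]$ and a constant $L_0\in\mathbb{R}$ such that $$\mathbb{L}(F)=L_0+\sup_{\mu\in\mathcal{P}(\mathbf{X})}\left\{\int_{\mathbf{X}}F\,d\mu-\mathbb{J}(\mu)\right\}$$ for all bounded continuous functions $F:\mathbf{X}\to\mathbb{R}$.
   Context: $C_b(\mathbf{X})$ denotes the space of all bounded continuous functions $F:\mathbf{X}\to\mathbb{R}$; real constants are identified with constant functions, and $F\le G$ is understood pointwise. A function $\mathbb{L}:C_b(\mathbf{X})\to\mathbb{R}$ (not assumed linear) is a Varadhan functional if: (i) $F\le G$ implies $\mathbb{L}(F)\le\mathbb{L}(G)$ for all $F,G\in C_b(\mathbf{X})$; and (ii) $\mathbb{L}(F+c)=\mathbb{L}(F)+c$ for all $F\in C_b(\mathbf{X})$ and all constants $c\in\mathbb{R}$. It is convex if it is a convex function on the vector space $C_b(\mathbf{X})$. A Varadhan functional $\mathbb{L}$ is $\sigma$-continuous if $\mathbb{L}(F_n)\to\mathbb{L}(0)$ for every sequence $(F_n)$ in $C_b(\mathbf{X})$ with $F_n\searrow 0$, i.e. such that $F_n(x)$ is non-increasing in $n$ and converges to $0$ for each $x\in\mathbf{X}$. $\mathcal{P}(\mathbf{X})$ denotes the metric space, with the Prokhorov metric (which induces the topology of weak convergence), of all (countably additive)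 probability measures on $\mathbf{X}$ with the Borel $\sigma$-field generated by all open sets. Lower semicontinuity of $\mathbb{J}$ is with respect to this topology. Convention: $\int F\,d\mu-\mathbb{J}(\mu)=-\infty$ when $\mathbb{J}(\mu)=\infty$. *)

theory Defs
  imports "HOL-Probability.Probability"
begin

section \<open>Varadhan functionals\<close>

definition varadhan_functional ::
  "(('a::topological_space \<Rightarrow>\<^sub>C real) \<Rightarrow> real) \<Rightarrow> bool" where
  "varadhan_functional L \<longleftrightarrow>
     (\<forall>F G. (\<forall>x. apply_bcontfun F x \<le> apply_bcontfun G x) \<longrightarrow> L F \<le> L G) \<and>
     (\<forall>F c. L (F + const_bcontfun c) = L F + c)"

definition sigma_continuous ::
  "(('a::topological_space \<Rightarrow>\<^sub>C real) \<Rightarrow> real) \<Rightarrow> bool" where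
  "sigma_continuous L \<longleftrightarrow>
     (\<forall>F :: nat \<Rightarrow> ('a \<Rightarrow>\<^sub>C real).
        (\<forall>x. decseq (\<lambda>n. apply_bcontfun (F n) x) \<and>
             (\<lambda>n. apply_bcontfun (F n) x) \<longlonglongrightarrow> 0)
        \<longrightarrow> (\<lambda>n. L (F n)) \<longlonglongrightarrow> L 0)"

section \<open>Borel probability measures with the Prokhorov metric\<close>

definition borel_prob_measures :: "'a::topological_space measure set" where
  "borel_prob_measures = {\<mu>. prob_space \<mu> \<and> sets \<mu> = sets borel}"

definition nbhd :: "real \<Rightarrow> 'a::metric_space set \<Rightarrow> 'a set" where
  "nbhd e A = (\<Union>a\<in>A. ball a e)"

definition prokhorov_bound :: "'a::metric_space measure \<Rightarrow> 'a measure \<Rightarrow> real \<Rightarrow> bool" where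
  "prokhorov_bound \<mu> \<nu> e \<longleftrightarrow>
     (\<forall>A\<in>sets borel. measure \<mu> A \<le> measure \<nu> (nbhd e A) + e \<and>
                     measure \<nu> A \<le> measure \<mu> (nbhd e A) + e)"

text \<open>The value 0 away from probability measures is a dummy: the library's locale of
  metric spaces on a carrier requires nonnegativity on the whole type.\<close>

definition prokhorov_dist :: "'a::metric_space measure \<Rightarrow> 'a measure \<Rightarrow> real" where
  "prokhorov_dist \<mu> \<nu> =
     (if \<mu> \<in> borel_prob_measures \<and> \<nu> \<in> borel_prob_measures
      then Inf {e. e > 0 \<and> prokhorov_bound \<mu> \<nu> e} else 0)"

lemma open_nbhd: "open (nbhd e A)"
  unfolding nbhd_def by blast

lemma nbhd_mono: "d \<le> e \<Longrightarrow> nbhd d A \<subseteq> nbhd e A"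
  unfolding nbhd_def by fastforce

lemma nbhd_nbhd: "nbhd d (nbhd e A) \<subseteq> nbhd (e + d) A"
proof
  fix x assume "x \<in> nbhd d (nbhd e A)"
  then obtain a y where "a \<in> A" "dist a y < e" "dist y x < d"
    unfolding nbhd_def by auto
  moreover have "dist a x \<le> dist a y + dist y x" by (rule dist_triangle)
  ultimately show "x \<in> nbhd (e + d) A" unfolding nbhd_def by fastforce
qed

lemma borel_prob_measuresD:
  assumes "\<mu> \<in> borel_prob_measures"
  shows "prob_space \<mu>" "sets \<mu> = sets borel" "space \<mu> = UNIV"
  using assms sets_eq_imp_space_eq[of \<mu> borel] by (auto simp: borel_prob_measures_def)

lemma prob_mono:
  assumes "\<mu> \<in> borel_prob_measures" "A \<subseteq> B" "B \<in> sets borel"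
  shows "measure \<mu> A \<le> measure \<mu> B"
proof -
  interpret prob_space \<mu> using assms borel_prob_measuresD by blast
  show ?thesis using assms borel_prob_measuresD by (intro finite_measure_mono) auto
qed

lemma prokhorov_bound_commute: "prokhorov_bound \<mu> \<nu> e \<longleftrightarrow> prokhorov_bound \<nu> \<mu> e"
  unfolding prokhorov_bound_def by blast

lemma prokhorov_bound_one:
  assumes "\<mu> \<in> borel_prob_measures" "\<nu> \<in> borel_prob_measures"
  shows "prokhorov_bound \<mu> \<nu> 1"
proof -
  interpret m: prob_space \<mu> using assms borel_prob_measuresD by blast
  interpret n: prob_space \<nu> using assms borel_prob_measuresD by blast
  show ?thesis unfolding prokhorov_bound_def
    by (auto intro: order.trans[OF m.prob_le_1] order.trans[OF n.prob_le_1])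
qed

lemma prokhorov_bound_mono:
  assumes "\<mu> \<in> borel_prob_measures" "\<nu> \<in> borel_prob_measures"
    and "prokhorov_bound \<mu> \<nu> d" "d \<le> e"
  shows "prokhorov_bound \<mu> \<nu> e"
  unfolding prokhorov_bound_def
proof
  fix A :: "'a set" assume A: "A \<in> sets borel"
  have "measure \<rho> (nbhd d A) \<le> measure \<rho> (nbhd e A)" if "\<rho> \<in> borel_prob_measures" for \<rho>
    using that assms(4) by (intro prob_mono nbhd_mono borel_open open_nbhd)
  then show "measure \<mu> A \<le> measure \<nu> (nbhd e A) + e \<and> measure \<nu> A \<le> measure \<mu> (nbhd e A) + e"
    using A assms unfolding prokhorov_bound_def by (meson add_mono order_trans)
qed

lemma prokhorov_bound_triangle:
  assumes "\<mu> \<in> borel_prob_measures" "\<nu> \<in> borel_prob_measures" "\<rho> \<in> borel_prob_measures"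
    and b: "prokhorov_bound \<mu> \<nu> d" "prokhorov_bound \<nu> \<rho> e"
  shows "prokhorov_bound \<mu> \<rho> (d + e)"
  unfolding prokhorov_bound_def
proof
  fix A :: "'a set" assume A: "A \<in> sets borel"
  have B: "nbhd r A \<in> sets borel" for r by (intro borel_open open_nbhd)
  have "measure \<mu> A \<le> measure \<rho> (nbhd e (nbhd d A)) + e + d"
    using b A B[of d] unfolding prokhorov_bound_def by fastforce
  moreover have "measure \<rho> (nbhd e (nbhd d A)) \<le> measure \<rho> (nbhd (d + e) A)"
    using assms B by (intro prob_mono nbhd_nbhd)
  moreover have "measure \<rho> A \<le> measure \<mu> (nbhd d (nbhd e A)) + d + e"
    using b A B[of e] unfolding prokhorov_bound_def by fastforce
  moreover have "measure \<mu> (nbhd d (nbhd e A)) \<le> measure \<mu> (nbhd (d + e) A)"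
    using assms B nbhd_nbhd[of d e A] by (intro prob_mono) (auto simp: add.commute)
  ultimately show "measure \<mu> A \<le> measure \<rho> (nbhd (d + e) A) + (d + e) \<and>
      measure \<rho> A \<le> measure \<mu> (nbhd (d + e) A) + (d + e)" by linarith
qed

lemma prokhorov_dist_nonneg: "0 \<le> prokhorov_dist \<mu> \<nu>"
proof (cases "\<mu> \<in> borel_prob_measures \<and> \<nu> \<in> borel_prob_measures")
  case True
  then have "1 \<in> {e. e > 0 \<and> prokhorov_bound \<mu> \<nu> e}"
    using prokhorov_bound_one by auto
  then have "0 \<le> Inf {e. e > 0 \<and> prokhorov_bound \<mu> \<nu> e}"
    by (intro cInf_greatest, blast) simp
  then show ?thesis using True by (simp add: prokhorov_dist_def)
qed (auto simp: prokhorov_dist_def)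

lemma prokhorov_dist_le:
  assumes "\<mu> \<in> borel_prob_measures" "\<nu> \<in> borel_prob_measures"
    and "0 < e" "prokhorov_bound \<mu> \<nu> e"
  shows "prokhorov_dist \<mu> \<nu> \<le> e"
  using assms by (auto simp: prokhorov_dist_def intro!: cInf_lower bdd_belowI[of _ 0])

lemma prokhorov_dist_less:
  assumes "\<mu> \<in> borel_prob_measures" "\<nu> \<in> borel_prob_measures" "prokhorov_dist \<mu> \<nu> < e"
  shows "prokhorov_bound \<mu> \<nu> e"
proof -
  have "1 \<in> {e. e > 0 \<and> prokhorov_bound \<mu> \<nu> e}"
    using assms prokhorov_bound_one by auto
  then have "{e. e > 0 \<and> prokhorov_bound \<mu> \<nu> e} \<noteq> {}" by blast
  then obtain d where "d < e" "prokhorov_bound \<mu> \<nu> d"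
    using assms cInf_lessD[of "{e. e > 0 \<and> prokhorov_bound \<mu> \<nu> e}" e]
    by (auto simp: prokhorov_dist_def)
  then show ?thesis using prokhorov_bound_mono assms by fastforce
qed

lemma closed_Inter_nbhd:
  assumes "closed A"
  shows "(\<Inter>n. nbhd (inverse (real (Suc n))) A) = A"
proof
  show "A \<subseteq> (\<Inter>n. nbhd (inverse (real (Suc n))) A)"
    unfolding nbhd_def by fastforce
  show "(\<Inter>n. nbhd (inverse (real (Suc n))) A) \<subseteq> A"
  proof
    fix x assume x: "x \<in> (\<Inter>n. nbhd (inverse (real (Suc n))) A)"
    have "\<exists>y\<in>A. dist y x < e" if "e > 0" for e
    proof -
      obtain n where n: "inverse (real (Suc n)) < e"
        using \<open>e > 0\<close> reals_Archimedean by blast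
      have "x \<in> nbhd (inverse (real (Suc n))) A" using x by blast
      then obtain y where "y \<in> A" "dist y x < inverse (real (Suc n))"
        unfolding nbhd_def by (auto simp del: of_nat_Suc)
      then show ?thesis using n by (meson order_less_trans)
    qed
    then have "x \<in> closure A" by (simp add: closure_approachable)
    then show "x \<in> A" using assms by simp
  qed
qed

lemma prokhorov_dist_zero_closed_le:
  assumes "\<mu> \<in> borel_prob_measures" "\<nu> \<in> borel_prob_measures"
    and "prokhorov_dist \<mu> \<nu> = 0" "closed A"
  shows "measure \<mu> A \<le> measure \<nu> A"
proof -
  interpret n: prob_space \<nu> using assms borel_prob_measuresD by blast
  let ?e = "\<lambda>n. inverse (real (Suc n))"
  have "(\<lambda>n. measure \<nu> (nbhd (?e n) A)) \<longlonglongrightarrow> measure \<nu> (\<Inter>n. nbhd (?e n) A)"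
  proof (rule n.finite_Lim_measure_decseq)
    show "range (\<lambda>n. nbhd (?e n) A) \<subseteq> sets \<nu>"
      unfolding borel_prob_measuresD(2)[OF assms(2)] by (intro image_subsetI borel_open open_nbhd)
    show "decseq (\<lambda>n. nbhd (?e n) A)"
      by (intro decseq_SucI nbhd_mono le_imp_inverse_le) simp_all
  qed
  then have "(\<lambda>n. measure \<nu> (nbhd (?e n) A)) \<longlonglongrightarrow> measure \<nu> A"
    by (simp only: closed_Inter_nbhd[OF assms(4)])
  from tendsto_add[OF this LIMSEQ_inverse_real_of_nat]
  have lim: "(\<lambda>n. measure \<nu> (nbhd (?e n) A) + ?e n) \<longlonglongrightarrow> measure \<nu> A"
    by (simp only: add_0_right)
  have "measure \<mu> A \<le> measure \<nu> (nbhd (?e n) A) + ?e n" for n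
  proof -
    have "prokhorov_dist \<mu> \<nu> < ?e n" unfolding assms(3) by simp
    with assms(1,2) have "prokhorov_bound \<mu> \<nu> (?e n)" by (rule prokhorov_dist_less)
    then show ?thesis using borel_closed[OF assms(4)] unfolding prokhorov_bound_def by blast
  qed
  then show ?thesis by (intro LIMSEQ_le_const[OF lim] exI[of _ 0]) blast
qed

lemma prokhorov_dist_commute: "prokhorov_dist \<mu> \<nu> = prokhorov_dist \<nu> \<mu>"
  unfolding prokhorov_dist_def using prokhorov_bound_commute[of \<mu> \<nu>] by auto

lemma prokhorov_dist_zero_imp_eq:
  assumes "\<mu> \<in> borel_prob_measures" "\<nu> \<in> borel_prob_measures" "prokhorov_dist \<mu> \<nu> = 0"
  shows "\<mu> = \<nu>"
proof -
  interpret m: prob_space \<mu> using assms borel_prob_measuresD by blast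
  interpret n: prob_space \<nu> using assms borel_prob_measuresD by blast
  have eq: "measure \<mu> A = measure \<nu> A" if "closed A" for A
  proof (rule order_antisym)
    show "measure \<mu> A \<le> measure \<nu> A"
      using assms that by (rule prokhorov_dist_zero_closed_le)
    have "prokhorov_dist \<nu> \<mu> = 0"
      using assms(3) prokhorov_dist_commute[of \<mu> \<nu>] by simp
    then show "measure \<nu> A \<le> measure \<mu> A"
      using assms(1,2) that by (intro prokhorov_dist_zero_closed_le)
  qed
  have b: "sets (borel :: 'a measure) = sigma_sets UNIV (Collect closed)"
    unfolding borel_eq_closed by simp
  show ?thesis
  proof (rule measure_eqI_generator_eq[where E="Collect closed" and \<Omega>=UNIV and A="\<lambda>_. UNIV"])
    show "Int_stable (Collect closed :: 'a set set)" by (simp add: Int_stable_def closed_Int)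
    show "sets \<mu> = sigma_sets UNIV (Collect closed)" "sets \<nu> = sigma_sets UNIV (Collect closed)"
      unfolding borel_prob_measuresD(2)[OF assms(1)] borel_prob_measuresD(2)[OF assms(2)] by (fact b)+
    show "emeasure \<mu> X = emeasure \<nu> X" if "X \<in> Collect closed" for X
      using that eq by (simp add: m.emeasure_eq_measure n.emeasure_eq_measure)
  qed auto
qed

lemma prokhorov_dist_self:
  assumes "\<mu> \<in> borel_prob_measures"
  shows "prokhorov_dist \<mu> \<mu> = 0"
proof -
  have "prokhorov_bound \<mu> \<mu> e" if "e > 0" for e
    unfolding prokhorov_bound_def
  proof
    fix A :: "'a set" assume "A \<in> sets borel"
    have "A \<subseteq> nbhd e A" unfolding nbhd_def using that by fastforce
    then have "measure \<mu> A \<le> measure \<mu> (nbhd e A)"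
      using assms by (intro prob_mono borel_open open_nbhd)
    then show "measure \<mu> A \<le> measure \<mu> (nbhd e A) + e \<and> measure \<mu> A \<le> measure \<mu> (nbhd e A) + e"
      using that by auto
  qed
  then have "prokhorov_dist \<mu> \<mu> \<le> 0 + e" if "e > 0" for e
    using that assms prokhorov_dist_le[of \<mu> \<mu> e] by simp
  then have "prokhorov_dist \<mu> \<mu> \<le> 0" by (rule field_le_epsilon)
  then show ?thesis using prokhorov_dist_nonneg[of \<mu> \<mu>] by linarith
qed

lemma prokhorov_dist_triangle:
  assumes "\<mu> \<in> borel_prob_measures" "\<nu> \<in> borel_prob_measures" "\<rho> \<in> borel_prob_measures"
  shows "prokhorov_dist \<mu> \<rho> \<le> prokhorov_dist \<mu> \<nu> + prokhorov_dist \<nu> \<rho>"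
proof (rule field_le_epsilon)
  fix e :: real assume "e > 0"
  let ?a = "prokhorov_dist \<mu> \<nu> + e/2" and ?b = "prokhorov_dist \<nu> \<rho> + e/2"
  have "prokhorov_bound \<mu> \<nu> ?a" "prokhorov_bound \<nu> \<rho> ?b"
    using assms \<open>e > 0\<close> by (auto intro!: prokhorov_dist_less)
  then have "prokhorov_bound \<mu> \<rho> (?a + ?b)"
    using assms prokhorov_bound_triangle by blast
  moreover have "?a + ?b > 0"
    using \<open>e > 0\<close> prokhorov_dist_nonneg[of \<mu> \<nu>] prokhorov_dist_nonneg[of \<nu> \<rho>] by linarith
  ultimately have "prokhorov_dist \<mu> \<rho> \<le> ?a + ?b"
    using assms by (intro prokhorov_dist_le) auto
  then show "prokhorov_dist \<mu> \<rho> \<le> prokhorov_dist \<mu> \<nu> + prokhorov_dist \<nu> \<rho> + e" by simp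
qed

lemma Metric_space_prokhorov:
  "Metric_space (borel_prob_measures :: 'a::metric_space measure set) prokhorov_dist"
proof
  show "prokhorov_dist \<mu> \<nu> = 0 \<longleftrightarrow> \<mu> = \<nu>"
    if "\<mu> \<in> borel_prob_measures" "\<nu> \<in> borel_prob_measures" for \<mu> \<nu> :: "'a measure"
    using that prokhorov_dist_zero_imp_eq prokhorov_dist_self by blast
qed (fact prokhorov_dist_nonneg prokhorov_dist_commute prokhorov_dist_triangle)+

abbreviation prokhorov_topology :: "'a::metric_space measure topology" where
  "prokhorov_topology \<equiv> Metric_space.mtopology borel_prob_measures prokhorov_dist"

section \<open>Lower semicontinuity\<close>

definition lower_semicontinuous_map :: "'b topology \<Rightarrow> ('b \<Rightarrow> 'c::linorder) \<Rightarrow> bool" where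
  "lower_semicontinuous_map T f \<longleftrightarrow> (\<forall>c. openin T {x \<in> topspace T. c < f x})"

end

theory Submission
  imports Defs
begin

text \<open>The representation is Fenchel duality, and the candidate for \<open>J\<close> is the smallest penalty
for which the supremum stays below \<open>L F - L 0\<close> for all \<open>F\<close>, namely
\<open>J \<mu> = SUP F. (\<integral>F d\<mu> - (L F - L 0))\<close>, which is nonnegative because of \<open>F = 0\<close>
(\<open>penalty\<close>). One inequality then holds by definition. The other asks, for each \<open>F\<close>, for a
probability measure \<open>\<mu>\<close> at which the supremum is attained, and that is a subgradient of \<open>L\<close> at
\<open>F\<close> which happens to be integration against a probability measure
(\<open>varadhan_subgradient_measure\<close>).

A linear subgradient \<open>l\<close> exists by a Hahn-Banach argument: a pointwise minimal convex minorant
vanishing at the origin is linear (\<open>convex_imp_linear_minorant\<close>). The two axioms of a Varadhan functional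
make \<open>l\<close> positive and give \<open>l 1 = 1\<close>. Sigma-continuity of \<open>L\<close>, which is only assumed at
the origin, nevertheless passes to \<open>l\<close>: if \<open>G\<^sub>n\<close> decreases to zero, then for every \<open>k > 0\<close>
the subgradient inequality at the point \<open>k G\<^sub>n\<close> reads
\<open>k l(G\<^sub>n) \<le> L(k G\<^sub>n) - L F + l F\<close>, whose right-hand side converges to the constant
\<open>L 0 - L F + l F\<close>; since \<open>k\<close> is arbitrary, \<open>l(G\<^sub>n)\<close> tends to zero
(\<open>subgradient_tends_to_zero\<close>).

A positive normalised linear functional with this continuity property is the integral of a Borel
probability measure (Daniell, \<open>I_eq_integral\<close>). On a metric space the indicator
of an open set is an increasing limit of continuous functions, and along such limits the continuity
property does what compactness does in the Riesz theorem.

Lower semicontinuity of the penalty follows once \<open>\<mu> \<mapsto> \<integral>F d\<mu>\<close> is lower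
semicontinuous for the Prokhorov metric (\<open>prokhorov_lsc_integral\<close>), because a supremum of lower
semicontinuous functions is lower semicontinuous.\<close>

section \<open>Linear minorants of convex functions\<close>

text \<open>An infimum of convex functions need not be convex. Convexity survives when the values at two
points, taken from two different members \<open>i\<close> and \<open>j\<close>, can be combined in a single
member \<open>k\<close>. This covers both infima needed below: over a chain of convex functions, and over the
parameter of a jointly convex function.\<close>

lemma convex_on_INF_directed:
  fixes f :: "'i \<Rightarrow> 'v::real_vector \<Rightarrow> real"
  assumes ne: "I \<noteq> {}"
    and bdd: "\<And>x. bdd_below ((\<lambda>i. f i x) ` I)"
    and dir: "\<And>i j x y u v. \<lbrakk>i \<in> I; j \<in> I; 0 \<le> u; 0 \<le> v; u + v = 1\<rbrakk> \<Longrightarrow>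
      \<exists>k\<in>I. f k (u *\<^sub>R x + v *\<^sub>R y) \<le> u * f i x + v * f j y"
  shows "convex_on UNIV (\<lambda>x. INF i\<in>I. f i x)"
  unfolding convex_on_def
proof (intro conjI ballI allI impI convex_UNIV)
  fix x y :: 'v and u v :: real
  assume uv: "0 \<le> u" "0 \<le> v" "u + v = 1"
  show "(INF i\<in>I. f i (u *\<^sub>R x + v *\<^sub>R y)) \<le> u * (INF i\<in>I. f i x) + v * (INF i\<in>I. f i y)"
  proof (rule field_le_epsilon)
    fix e :: real assume "e > 0"
    have "\<exists>i\<in>I. f i z < (INF i\<in>I. f i z) + e" for z
      using cINF_less_iff[OF ne bdd, of z "(INF i\<in>I. f i z) + e"] \<open>e > 0\<close> by simp
    then obtain i j where i: "i \<in> I" "f i x < (INF i\<in>I. f i x) + e"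
      and j: "j \<in> I" "f j y < (INF i\<in>I. f i y) + e" by meson
    obtain k where k: "k \<in> I" "f k (u *\<^sub>R x + v *\<^sub>R y) \<le> u * f i x + v * f j y"
      using dir[OF i(1) j(1) uv] by blast
    have "(INF i\<in>I. f i (u *\<^sub>R x + v *\<^sub>R y)) \<le> f k (u *\<^sub>R x + v *\<^sub>R y)"
      by (rule cINF_lower[OF bdd k(1)])
    also have "\<dots> \<le> u * f i x + v * f j y" by (rule k(2))
    also have "\<dots> \<le> u * ((INF i\<in>I. f i x) + e) + v * ((INF i\<in>I. f i y) + e)"
      using i(2) j(2) uv by (intro add_mono mult_left_mono) auto
    also have "\<dots> = u * (INF i\<in>I. f i x) + v * (INF i\<in>I. f i y) + (u + v) * e"
      by (simp add: algebra_simps)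
    finally show "(INF i\<in>I. f i (u *\<^sub>R x + v *\<^sub>R y))
        \<le> u * (INF i\<in>I. f i x) + v * (INF i\<in>I. f i y) + e"
      using uv by simp
  qed
qed

lemma convex_onE:
  assumes "convex_on UNIV f" "0 \<le> u" "0 \<le> v" "u + v = 1"
  shows "f (u *\<^sub>R x + v *\<^sub>R y) \<le> u * f x + v * f y"
  using assms unfolding convex_on_def by blast

text \<open>The origin is the midpoint of \<open>x\<close> and \<open>- x\<close>. For minorants \<open>G\<close> of a fixed
\<open>q\<close> this yields the common lower bound \<open>- q (- x)\<close>, so that chains of minorants have
finite infima.\<close>

lemma convex_ge_neg_reflect:
  fixes f :: "'v::real_vector \<Rightarrow> real"
  assumes "convex_on UNIV f" "f 0 = 0"
  shows "- f (- x) \<le> f x"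
  using convex_onE[OF assms(1), of "1/2" "1/2" x "- x"] assms(2) by simp

definition convex_minorants :: "('v::real_vector \<Rightarrow> real) \<Rightarrow> ('v \<Rightarrow> real) set" where
  "convex_minorants q = {G. convex_on UNIV G \<and> G 0 = 0 \<and> (\<forall>x. G x \<le> q x)}"

text \<open>Zorn's lemma for the reversed pointwise order: a nonempty chain of convex minorants has its
pointwise infimum as a bound. Since all functions are defined on the whole space, no partially defined
extensions have to be compared.\<close>

lemma exists_minimal_convex_minorant:
  fixes q :: "'v::real_vector \<Rightarrow> real"
  assumes "convex_on UNIV q" "q 0 = 0"
  obtains m where "m \<in> convex_minorants q"
    "\<And>G. G \<in> convex_minorants q \<Longrightarrow> (\<And>x. G x \<le> m x) \<Longrightarrow> G = m"
proof -
  let ?A = "convex_minorants q" and ?P = "\<lambda>G H :: 'v \<Rightarrow> real. \<forall>x. H x \<le> G x"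
  have qA: "q \<in> ?A" using assms by (simp add: convex_minorants_def)
  have "\<exists>m\<in>?A. \<forall>G\<in>?A. ?P m G \<longrightarrow> G = m"
  proof (rule predicate_Zorn)
    show "partial_order_on ?A (relation_of ?P ?A)"
      by (rule partial_order_on_relation_ofI) (auto intro: order_trans simp: fun_eq_iff order.eq_iff)
    fix C assume C: "C \<in> Chains (relation_of ?P ?A)"
    then have CA: "C \<subseteq> ?A" by (auto simp: Chains_def relation_of_def)
    show "\<exists>u\<in>?A. \<forall>G\<in>C. ?P G u"
    proof (cases "C = {}")
      case True
      then show ?thesis using qA by blast
    next
      case False
      define u where "u x = (INF G\<in>C. G x)" for x
      have low: "- q (- x) \<le> G x" if "G \<in> C" for G x
        using that CA convex_ge_neg_reflect[of G x] unfolding convex_minorants_def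
        by (smt (verit, best) mem_Collect_eq subsetD)
      then have bdd: "bdd_below ((\<lambda>G. G x) ` C)" for x by (intro bdd_belowI2) auto
      have le: "u x \<le> G x" if "G \<in> C" for G x
        unfolding u_def by (rule cINF_lower[OF bdd that])
      have "convex_on UNIV u"
        unfolding u_def
      proof (rule convex_on_INF_directed[OF False bdd])
        fix G H x y and a b :: real
        assume *: "G \<in> C" "H \<in> C" "0 \<le> a" "0 \<le> b" "a + b = 1"
        obtain K where K: "K \<in> C" "\<forall>x. K x \<le> G x" "\<forall>x. K x \<le> H x"
          using C *(1,2) unfolding Chains_def relation_of_def by blast
        have "K (a *\<^sub>R x + b *\<^sub>R y) \<le> a * K x + b * K y"
          using K(1) CA * by (intro convex_onE) (auto simp: convex_minorants_def)
        also have "\<dots> \<le> a * G x + b * H y"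
          using K * by (intro add_mono mult_left_mono) auto
        finally show "\<exists>K\<in>C. K (a *\<^sub>R x + b *\<^sub>R y) \<le> a * G x + b * H y" using K(1) by blast
      qed
      moreover have "u 0 = 0"
      proof -
        have "(\<lambda>G. G 0) ` C = {0}"
          using CA False unfolding convex_minorants_def by (auto intro: rev_image_eqI)
        then show ?thesis by (simp add: u_def)
      qed
      moreover have "u x \<le> q x" for x
      proof -
        obtain G where G: "G \<in> C" using False by blast
        then have "G x \<le> q x" using CA by (auto simp: convex_minorants_def)
        then show ?thesis using le[OF G, of x] by simp
      qed
      ultimately show ?thesis using le by (auto simp: convex_minorants_def)
    qed
  qed
  then show thesis using that by blast
qed

text \<open>The analytic form of the Hahn-Banach theorem. A minimal convex minorant \<open>m\<close> is linear because
two constructions produce minorants below \<open>m\<close>, which must therefore coincide with \<open>m\<close>: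
the function \<open>x \<mapsto> t m(x/t)\<close> for \<open>t \<ge> 1\<close>, giving positive homogeneity, and
\<open>x \<mapsto> inf t \<ge> 0. m(x + t h) - t m(h)\<close>, giving superadditivity.\<close>

theorem convex_imp_linear_minorant:
  fixes q :: "'v::real_vector \<Rightarrow> real"
  assumes "convex_on UNIV q" "q 0 = 0"
  obtains l where "linear l" "\<And>x. l x \<le> q x"
proof -
  obtain m where m: "m \<in> convex_minorants q"
    and min: "\<And>G. G \<in> convex_minorants q \<Longrightarrow> (\<And>x. G x \<le> m x) \<Longrightarrow> G = m"
    using exists_minimal_convex_minorant[OF assms] by blast
  have conv: "convex_on UNIV m" and m0: "m 0 = 0" and mq: "m x \<le> q x" for x
    using m by (auto simp: convex_minorants_def)
  have minorant: "G \<in> convex_minorants q"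
    if "convex_on UNIV G" "G 0 = 0" "\<And>x. G x \<le> m x" for G
    using that mq by (auto simp: convex_minorants_def intro: order_trans)
  have hom_ge1: "m (t *\<^sub>R x) = t * m x" if "1 \<le> t" for t x
  proof -
    let ?G = "\<lambda>x. t * m (x /\<^sub>R t)"
    have "?G = m"
    proof (rule min[OF minorant])
      show "convex_on UNIV ?G"
        unfolding convex_on_def
      proof (intro conjI ballI allI impI convex_UNIV)
        fix x y and u v :: real assume uv: "0 \<le> u" "0 \<le> v" "u + v = 1"
        have "m ((u *\<^sub>R x + v *\<^sub>R y) /\<^sub>R t) \<le> u * m (x /\<^sub>R t) + v * m (y /\<^sub>R t)"
          using convex_onE[OF conv uv, of "x /\<^sub>R t" "y /\<^sub>R t"]
          by (simp add: scaleR_add_right mult.commute)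
        then have "t * m ((u *\<^sub>R x + v *\<^sub>R y) /\<^sub>R t) \<le> t * (u * m (x /\<^sub>R t) + v * m (y /\<^sub>R t))"
          using that by (intro mult_left_mono) auto
        then show "?G (u *\<^sub>R x + v *\<^sub>R y) \<le> u * ?G x + v * ?G y" by (simp add: algebra_simps)
      qed
      show "?G x \<le> m x" for x
      proof -
        have "m (x /\<^sub>R t) \<le> inverse t * m x"
          using convex_onE[OF conv, of "inverse t" "1 - inverse t" x 0] that m0
          by (simp add: inverse_le_1_iff)
        then have "t * m (x /\<^sub>R t) \<le> t * (inverse t * m x)"
          using that by (intro mult_left_mono) auto
        then show ?thesis using that by (simp flip: mult.assoc)
      qed
      then show "?G x \<le> m x" for x .
    qed (simp add: m0)
    from fun_cong[OF this, of "t *\<^sub>R x"] show ?thesis using that by simp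
  qed
  have hom: "m (t *\<^sub>R x) = t * m x" if "0 \<le> t" for t x
  proof (cases "t \<ge> 1 \<or> t = 0")
    case True
    then show ?thesis using hom_ge1 m0 by auto
  next
    case False
    then have "m x = inverse t * m (t *\<^sub>R x)"
      using that hom_ge1[of "inverse t" "t *\<^sub>R x"] by (simp add: one_le_inverse_iff)
    then show ?thesis using False by simp
  qed
  have sub: "m (x + y) \<le> m x + m y" for x y
    using convex_onE[OF conv, of "1/2" "1/2" "2 *\<^sub>R x" "2 *\<^sub>R y"] by (simp add: hom)
  have super: "m x + m h \<le> m (x + h)" for x h
  proof -
    let ?f = "\<lambda>t x. m (x + t *\<^sub>R h) - t * m h"
    let ?G = "\<lambda>x. INF t\<in>{0..}. ?f t x"
    have "- m (- x) \<le> ?f t x" if "t \<ge> 0" for t x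
      using sub[of "x + t *\<^sub>R h" "- x"] hom[OF that, of h] by simp
    then have bdd: "bdd_below ((\<lambda>t. ?f t x) ` {0..})" for x by (intro bdd_belowI2) auto
    have "?G = m"
    proof (rule min[OF minorant])
      show "convex_on UNIV ?G"
      proof (rule convex_on_INF_directed[OF _ bdd])
        fix s t u v :: real and x y
        assume *: "s \<in> {0..}" "t \<in> {0..}" "0 \<le> u" "0 \<le> v" "u + v = 1"
        have "?f (u * s + v * t) (u *\<^sub>R x + v *\<^sub>R y) \<le> u * ?f s x + v * ?f t y"
          using convex_onE[OF conv *(3-5), of "x + s *\<^sub>R h" "y + t *\<^sub>R h"]
          by (simp add: algebra_simps)
        moreover have "u * s + v * t \<in> {0..}" using * by simp
        ultimately show "\<exists>r\<in>{0..}. ?f r (u *\<^sub>R x + v *\<^sub>R y) \<le> u * ?f s x + v * ?f t y" by blast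
      qed simp
      show "?G 0 = 0" by (simp add: hom)
      show "?G x \<le> m x" for x using cINF_lower[OF bdd, of 0 x] by simp
      then show "?G x \<le> m x" for x .
    qed
    \<comment> \<open>the infimum equals its value at t = 0, so it is below the value at t = 1\<close>
    then have "m x \<le> ?f 1 x" using cINF_lower[OF bdd, of 1 x] fun_cong[of ?G m x] by simp
    then show ?thesis by simp
  qed
  have add: "m (x + y) = m x + m y" for x y using sub super by (rule antisym)
  have neg: "m (- x) = - m x" for x using add[of x "- x"] m0 by simp
  have "linear m"
  proof (rule linearI)
    show "m (r *\<^sub>R x) = r *\<^sub>R m x" for r x
      using hom[of r x] hom[of "- r" x] neg[of "r *\<^sub>R x"] by (cases "r \<ge> 0") auto
  qed (rule add)
  then show thesis using that mq by blast
qed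

section \<open>Bounded continuous functions and layers\<close>

lemma bcontfun_plus_minus:
  fixes f g :: "'a::topological_space \<Rightarrow> real"
  assumes "f \<in> bcontfun" "g \<in> bcontfun"
  shows bcontfun_add: "(\<lambda>x. f x + g x) \<in> bcontfun"
    and bcontfun_diff: "(\<lambda>x. f x - g x) \<in> bcontfun"
  using plus_cont[OF assms] minus_cont[OF assms] by auto

lemma bcontfun_cmult:
  fixes f :: "'a::topological_space \<Rightarrow> real"
  shows "f \<in> bcontfun \<Longrightarrow> (\<lambda>x. c * f x) \<in> bcontfun"
  using scaleR_cont[of f c] by simp

lemma bcontfun_minmax:
  fixes f g :: "'a::topological_space \<Rightarrow> real"
  assumes "f \<in> bcontfun" "g \<in> bcontfun"
  shows bcontfun_min: "(\<lambda>x. min (f x) (g x)) \<in> bcontfun"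
    and bcontfun_max: "(\<lambda>x. max (f x) (g x)) \<in> bcontfun"
proof -
  have c: "continuous_on UNIV f" "continuous_on UNIV g"
    and "bounded (range f)" "bounded (range g)" using assms by (auto simp: bcontfun_def)
  then obtain B C where "\<And>x. norm (f x) \<le> B" "\<And>x. norm (g x) \<le> C"
    unfolding bounded_iff by blast
  then have "norm (min (f x) (g x)) \<le> max B C" "norm (max (f x) (g x)) \<le> max B C" for x
    by (smt (verit) real_norm_def)+
  then show "(\<lambda>x. min (f x) (g x)) \<in> bcontfun" "(\<lambda>x. max (f x) (g x)) \<in> bcontfun"
    using c by (auto intro!: bcontfun_normI continuous_intros)
qed

lemma bcontfun_sum:
  fixes f :: "'i \<Rightarrow> 'a::topological_space \<Rightarrow> real"
  assumes "\<And>i. i \<in> I \<Longrightarrow> f i \<in> bcontfun"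
  shows "(\<lambda>x. \<Sum>i\<in>I. f i x) \<in> bcontfun"
  using assms by (induction I rule: infinite_finite_induct) (auto intro: bcontfun_add const_bcontfun)

text \<open>Layer arguments need values in the unit interval; both sides of the statements in question are
compatible with affine changes of the function.\<close>

lemma bcontfun_rescale:
  fixes f :: "'a::topological_space \<Rightarrow> real"
  assumes "f \<in> bcontfun"
  obtains a b g where "b > 0" "g \<in> bcontfun" "\<And>x. 0 \<le> g x" "\<And>x. g x \<le> 1"
    "f = (\<lambda>x. b * g x + a)"
proof -
  obtain B where B: "\<And>x. \<bar>f x\<bar> \<le> B" "B > 0"
    using assms unfolding bcontfun_def bounded_pos by (auto simp: real_norm_def)
  let ?g = "\<lambda>x. inverse (2 * B) * (f x + B)"
  have "?g \<in> bcontfun"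
    by (rule bcontfun_cmult[OF bcontfun_add[OF assms const_bcontfun]])
  moreover have "0 \<le> ?g x" "?g x \<le> 1" for x
    using B(1)[of x] B(2) by (auto simp: field_simps abs_le_iff)
  moreover have "f = (\<lambda>x. (2 * B) * ?g x + (- B))" using B(2) by (auto simp: field_simps)
  ultimately show thesis using that[of "2 * B" ?g "- B"] B(2) by simp
qed

lemma integrable_bcontfun:
  assumes "\<mu> \<in> borel_prob_measures" "f \<in> bcontfun"
  shows "integrable \<mu> (f :: 'a::topological_space \<Rightarrow> real)"
proof -
  interpret prob_space \<mu> using assms(1) by (simp add: borel_prob_measures_def)
  have "sets \<mu> = sets borel" using assms(1) by (simp add: borel_prob_measures_def)
  then have "f \<in> borel_measurable \<mu>"
    using assms(2) borel_measurable_continuous_onI[of f] measurable_cong_sets[of \<mu> borel borel borel]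
    by (auto simp: bcontfun_def)
  moreover obtain B where "\<And>x. norm (f x) \<le> B"
    using assms(2) unfolding bcontfun_def bounded_iff by auto
  ultimately show ?thesis by (intro integrable_const_bound[of _ B]) auto
qed

text \<open>The slice of \<open>t\<close> between the heights \<open>k/n\<close> and \<open>(k+1)/n\<close> is
\<open>min t ((k+1)/n) - min t (k/n)\<close>, so the sum of the slices telescopes.\<close>

lemma sum_clamped_layers:
  fixes t :: real and n :: nat
  assumes "n > 0" "0 \<le> t"
  shows "(\<Sum>k<n. min (1 / n) (max 0 (t - k / n))) = min t 1"
proof -
  have "min d (max 0 (t - a)) = min t (a + d) - min t a" if "d \<ge> 0" for a d
    using that by (auto simp: min_def max_def)
  from this[of "1 / n"]
  have "min (1 / n) (max 0 (t - k / n)) = min t (Suc k / n) - min t (k / n)" for k :: nat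
    by (simp add: add_divide_distrib add.commute)
  then show ?thesis
    using assms sum_lessThan_telescope[of "\<lambda>k. min t (k / n)" n] by simp
qed

text \<open>A discrete layer-cake formula: each slice lies below \<open>1/n\<close> times the indicator of
\<open>k/n < t\<close>, which in turn lies below the corresponding slice of \<open>t + 1/n\<close>.\<close>

lemma sum_layers_bounds:
  fixes t :: real and n :: nat
  assumes "n > 0" "0 \<le> t" "t \<le> 1"
  shows "t \<le> (\<Sum>k<n. of_bool (k / n < t) / n)" "(\<Sum>k<n. of_bool (k / n < t) / n) \<le> t + 1 / n"
proof -
  have "t = (\<Sum>k<n. min (1 / n) (max 0 (t - k / n)))"
    using sum_clamped_layers[of n t] assms by simp
  also have "\<dots> \<le> (\<Sum>k<n. of_bool (k / n < t) / n)"
    using assms by (intro sum_mono) (auto simp: min_def max_def)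
  finally show "t \<le> (\<Sum>k<n. of_bool (k / n < t) / n)" .
  have "(\<Sum>k<n. of_bool (k / n < t) / n) \<le> (\<Sum>k<n. min (1 / n) (max 0 (t + 1 / n - k / n)))"
  proof (rule sum_mono)
    have "of_bool (a < t) * d \<le> min d (max 0 (t + d - a))" if "d \<ge> 0" for a d
      using that by (auto simp: min_def max_def)
    from this[of "1 / n"]
    show "of_bool (k / n < t) / n \<le> min (1 / n) (max 0 (t + 1 / n - k / n))" for k :: nat
      by simp
  qed
  also have "\<dots> \<le> t + 1 / n"
    using sum_clamped_layers[of n "t + 1 / n"] assms by simp
  finally show "(\<Sum>k<n. of_bool (k / n < t) / n) \<le> t + 1 / n" .
qed

text \<open>Integrals are thereby controlled by the measures of finitely many open superlevel sets, with an error
that does not depend on the measure. This reduces statements on integrals of continuous functions to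
statements on open sets.\<close>

lemma integral_layers_bounds:
  fixes f :: "'a::topological_space \<Rightarrow> real" and n :: nat
  assumes mu: "\<mu> \<in> borel_prob_measures" and f: "f \<in> bcontfun" "\<And>x. 0 \<le> f x" "\<And>x. f x \<le> 1"
    and n: "n > 0"
  shows "(\<integral>x. f x \<partial>\<mu>) \<le> (\<Sum>k<n. measure \<mu> {x. k / n < f x} / n)"
    and "(\<Sum>k<n. measure \<mu> {x. k / n < f x} / n) \<le> (\<integral>x. f x \<partial>\<mu>) + 1 / n"
proof -
  interpret prob_space \<mu> using mu by (simp add: borel_prob_measures_def)
  have sp: "space \<mu> = UNIV" and st: "sets \<mu> = sets borel"
    using mu sets_eq_imp_space_eq[of \<mu> borel] by (auto simp: borel_prob_measures_def)
  have U[measurable]: "{x. real k / real n < f x} \<in> sets \<mu>" for k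
    unfolding st using f(1) by (intro borel_open open_Collect_less) (auto simp: bcontfun_def)
  let ?S = "\<lambda>x. \<Sum>k<n. indicator {x. k / n < f x} x / real n"
  have eq: "?S x = (\<Sum>k<n. of_bool (k / n < f x) / n)" for x
    by (intro sum.cong) (auto simp: indicator_def)
  have int: "integrable \<mu> f" by (rule integrable_bcontfun[OF mu f(1)])
  have intS: "integrable \<mu> ?S"
    by (intro Bochner_Integration.integrable_sum integrable_divide) (auto simp: emeasure_eq_measure)
  have "(\<integral>x. ?S x \<partial>\<mu>) = (\<Sum>k<n. \<integral>x. indicator {x. k / n < f x} x / real n \<partial>\<mu>)"
    by (intro Bochner_Integration.integral_sum integrable_divide) (auto simp: emeasure_eq_measure)
  also have "\<dots> = (\<Sum>k<n. measure \<mu> {x. k / n < f x} / n)"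
    by (simp add: sp)
  finally have S: "(\<integral>x. ?S x \<partial>\<mu>) = (\<Sum>k<n. measure \<mu> {x. k / n < f x} / n)" .
  show "(\<integral>x. f x \<partial>\<mu>) \<le> (\<Sum>k<n. measure \<mu> {x. k / n < f x} / n)"
    unfolding S[symmetric] eq using int intS[unfolded eq] sum_layers_bounds(1)[OF n] f(2,3)
    by (intro integral_mono) auto
  have "(\<integral>x. ?S x \<partial>\<mu>) \<le> (\<integral>x. f x + 1 / n \<partial>\<mu>)"
    unfolding eq using int intS[unfolded eq] sum_layers_bounds(2)[OF n] f(2,3)
    by (intro integral_mono) auto
  also have "\<dots> = (\<integral>x. f x \<partial>\<mu>) + 1 / n"
    using int by (simp add: prob_space)
  finally show "(\<Sum>k<n. measure \<mu> {x. k / n < f x} / n) \<le> (\<integral>x. f x \<partial>\<mu>) + 1 / n"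
    unfolding S .
qed

section \<open>Lower semicontinuity of integrals for the Prokhorov metric\<close>

text \<open>An open set is the increasing union of the sets of points at distance at least \<open>1/n\<close> from its
complement. One of these carries mass above \<open>c\<close>, and its small neighbourhoods are still contained
in \<open>U\<close>, where a Prokhorov-close measure has to put nearly that mass.\<close>

lemma prokhorov_lsc_measure_open:
  assumes mu: "\<mu> \<in> borel_prob_measures" and "open U" "c < measure \<mu> U"
  shows "\<exists>r>0. \<forall>\<nu>\<in>borel_prob_measures. prokhorov_dist \<mu> \<nu> < r \<longrightarrow> c < measure \<nu> U"
proof -
  interpret prob_space \<mu> using mu borel_prob_measuresD by blast
  let ?e = "\<lambda>n. inverse (real (Suc n))"
  define A where "A n = - nbhd (?e n) (- U)" for n
  have Ab: "A n \<in> sets borel" for n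
    unfolding A_def by (intro borel_closed closed_Compl open_nbhd)
  have "(\<lambda>n. measure \<mu> (A n)) \<longlonglongrightarrow> measure \<mu> (\<Union>n. A n)"
  proof (rule finite_Lim_measure_incseq)
    show "range A \<subseteq> sets \<mu>" using Ab borel_prob_measuresD(2)[OF mu] by auto
    have "nbhd (?e (Suc n)) (- U) \<subseteq> nbhd (?e n) (- U)" for n
      by (intro nbhd_mono le_imp_inverse_le) simp_all
    then show "incseq A" unfolding A_def by (intro incseq_SucI) blast
  qed
  moreover have "(\<Union>n. A n) = U"
    using closed_Inter_nbhd[of "- U"] \<open>open U\<close> unfolding A_def closed_def by auto
  ultimately obtain n where n: "c < measure \<mu> (A n)"
    using order_tendstoD(1)[of _ _ sequentially c] assms(3) by (metis eventually_sequentially order_refl)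
  let ?r = "min (?e n) ((measure \<mu> (A n) - c) / 2)"
  have sub: "nbhd ?r (A n) \<subseteq> U"
  proof
    fix y assume "y \<in> nbhd ?r (A n)"
    then obtain a where "a \<in> A n" "dist a y < ?e n" unfolding nbhd_def by auto
    then show "y \<in> U" unfolding A_def nbhd_def by (auto simp: dist_commute)
  qed
  have "c < measure \<nu> U" if nu: "\<nu> \<in> borel_prob_measures" and "prokhorov_dist \<mu> \<nu> < ?r" for \<nu>
  proof -
    have "prokhorov_bound \<mu> \<nu> ?r" using prokhorov_dist_less[OF mu that] .
    then have "measure \<mu> (A n) \<le> measure \<nu> (nbhd ?r (A n)) + ?r"
      using Ab unfolding prokhorov_bound_def by blast
    also have "\<dots> \<le> measure \<nu> U + (measure \<mu> (A n) - c) / 2"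
      using prob_mono[OF nu sub] \<open>open U\<close> by (intro add_mono min.cobounded2) simp_all
    finally show ?thesis using n by (simp add: field_simps)
  qed
  moreover have "?r > 0" using n by simp
  ultimately show ?thesis by blast
qed

lemma prokhorov_lsc_integral:
  fixes f :: "'a::metric_space \<Rightarrow> real"
  assumes mu: "\<mu> \<in> borel_prob_measures" and f: "f \<in> bcontfun" and c: "c < (\<integral>x. f x \<partial>\<mu>)"
  shows "\<exists>r>0. \<forall>\<nu>\<in>borel_prob_measures. prokhorov_dist \<mu> \<nu> < r \<longrightarrow> c < (\<integral>x. f x \<partial>\<nu>)"
proof -
  obtain a b g where b: "b > 0" and g: "g \<in> bcontfun" "\<And>x. 0 \<le> g x" "\<And>x. g x \<le> 1"
    and fg: "f = (\<lambda>x. b * g x + a)"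
    using bcontfun_rescale[OF f] by blast
  have int: "(\<integral>x. f x \<partial>\<nu>) = b * (\<integral>x. g x \<partial>\<nu>) + a" if nu: "\<nu> \<in> borel_prob_measures" for \<nu>
  proof -
    interpret prob_space \<nu> using nu borel_prob_measuresD by blast
    show ?thesis unfolding fg using integrable_bcontfun[OF nu g(1)] by (simp add: prob_space)
  qed
  \<comment> \<open>d is the gap for the rescaled function g; one part 1 / n of it pays for the layers, the rest e for the open sets\<close>
  define d where "d = (\<integral>x. g x \<partial>\<mu>) - (c - a) / b"
  have "d > 0" using c b unfolding d_def int[OF mu] by (simp add: field_simps)
  then obtain m where m: "inverse (real (Suc m)) < d" using reals_Archimedean by blast
  define n where "n = Suc m"
  have n: "n > 0" "1 / n < d" using m by (auto simp: n_def field_simps)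
  let ?U = "\<lambda>k::nat. {x. k / n < g x}"
  define e where "e = d - 1 / n"
  have "\<exists>r>0. \<forall>\<nu>\<in>borel_prob_measures. prokhorov_dist \<mu> \<nu> < r \<longrightarrow>
      measure \<mu> (?U k) - e < measure \<nu> (?U k)" for k
    using g(1) n by (intro prokhorov_lsc_measure_open[OF mu] open_Collect_less)
      (auto simp: bcontfun_def e_def)
  then obtain r where r: "\<And>k. r k > 0"
    "\<And>k \<nu>. \<nu> \<in> borel_prob_measures \<Longrightarrow> prokhorov_dist \<mu> \<nu> < r k \<Longrightarrow>
      measure \<mu> (?U k) - e < measure \<nu> (?U k)"
    by metis
  let ?R = "Min (r ` {..<n})"
  have "?R > 0" using r(1) n by (subst Min_gr_iff) auto
  moreover have "c < (\<integral>x. f x \<partial>\<nu>)" if nu: "\<nu> \<in> borel_prob_measures" and "prokhorov_dist \<mu> \<nu> < ?R" for \<nu>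
  proof -
    have close: "measure \<mu> (?U k) - e < measure \<nu> (?U k)" if "k < n" for k
    proof (rule r(2)[OF nu])
      have "?R \<le> r k" using that by (intro Min_le) auto
      then show "prokhorov_dist \<mu> \<nu> < r k" using \<open>prokhorov_dist \<mu> \<nu> < ?R\<close> by simp
    qed
    have "(\<integral>x. g x \<partial>\<mu>) - e \<le> (\<Sum>k<n. measure \<mu> (?U k) / n) - e"
      using integral_layers_bounds(1)[OF mu g n(1)] by simp
    also have "\<dots> = (\<Sum>k<n. (measure \<mu> (?U k) - e) / n)"
      using n by (simp add: diff_divide_distrib sum_subtractf)
    also have "\<dots> < (\<Sum>k<n. measure \<nu> (?U k) / n)"
      using close n by (intro sum_strict_mono divide_strict_right_mono) auto
    also have "\<dots> \<le> (\<integral>x. g x \<partial>\<nu>) + 1 / n"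
      by (rule integral_layers_bounds(2)[OF nu g n(1)])
    finally have "(c - a) / b < (\<integral>x. g x \<partial>\<nu>)" by (simp add: e_def d_def)
    then show ?thesis unfolding int[OF nu] using b by (simp add: field_simps)
  qed
  ultimately show ?thesis by blast
qed

section \<open>The Daniell representation\<close>

definition subfunctions :: "'a::topological_space set \<Rightarrow> ('a \<Rightarrow> real) set" where
  "subfunctions U = {f \<in> bcontfun. \<forall>x. 0 \<le> f x \<and> f x \<le> indicator U x}"

lemma subfunctionsD:
  assumes "f \<in> subfunctions U"
  shows "f \<in> bcontfun" "0 \<le> f x" "f x \<le> 1" "x \<notin> U \<Longrightarrow> f x = 0"
  using assms unfolding subfunctions_def
  by (cases "x \<in> U"; auto dest!: spec[of _ x])+

lemma subfunctionsI:
  assumes "f \<in> bcontfun" "\<And>x. 0 \<le> f x" "\<And>x. x \<in> U \<Longrightarrow> f x \<le> 1" "\<And>x. x \<notin> U \<Longrightarrow> f x \<le> 0"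
  shows "f \<in> subfunctions U"
  using assms unfolding subfunctions_def by (auto simp: indicator_def)

lemma zero_in_subfunctions: "(\<lambda>x. 0) \<in> subfunctions U"
  by (intro subfunctionsI const_bcontfun) auto

lemma subfunctions_mono: "U \<subseteq> V \<Longrightarrow> subfunctions U \<subseteq> subfunctions V"
  by (intro subsetI subfunctionsI) (auto dest: subfunctionsD)

text \<open>The functions \<open>min 1 (n * infdist x (- U))\<close>. The whole space is treated separately because the
distance to the empty set is zero by convention.\<close>

lemma open_indicator_incseq_limit:
  fixes U :: "'a::metric_space set"
  assumes "open U"
  obtains h :: "nat \<Rightarrow> 'a \<Rightarrow> real" where "\<And>n. h n \<in> subfunctions U"
    "\<And>x. incseq (\<lambda>n. h n x)" "\<And>x. x \<in> U \<Longrightarrow> (\<lambda>n. h n x) \<longlonglongrightarrow> 1"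
proof (cases "U = UNIV")
  case True
  then have "(\<lambda>x. 1) \<in> subfunctions U" by (intro subfunctionsI const_bcontfun) auto
  then show thesis by (intro that[of "\<lambda>n x. 1"]) (auto simp: incseq_def)
next
  case False
  let ?h = "\<lambda>n x. min 1 (real n * infdist x (- U))"
  have "?h n \<in> bcontfun" for n
    by (rule bcontfun_normI[of _ 1]) (auto intro!: continuous_intros simp: infdist_nonneg)
  then have "?h n \<in> subfunctions U" for n
    by (rule subfunctionsI) (auto simp: infdist_nonneg)
  moreover have "incseq (\<lambda>n. ?h n x)" for x
    by (intro incseq_SucI min.mono mult_right_mono infdist_nonneg) auto
  moreover have "(\<lambda>n. ?h n x) \<longlonglongrightarrow> 1" if "x \<in> U" for x
  proof -
    have "infdist x (- U) \<noteq> 0"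
      using in_closed_iff_infdist_zero[of "- U" x] False that \<open>open U\<close> by (auto simp: closed_def)
    then have d: "infdist x (- U) > 0" using infdist_nonneg[of x "- U"] by linarith
    obtain N where N: "1 < real N * infdist x (- U)" using reals_Archimedean3[OF d] by blast
    have "?h n x = 1" if "n \<ge> N" for n
    proof -
      have "real N * infdist x (- U) \<le> real n * infdist x (- U)"
        using that d by (intro mult_right_mono) auto
      then show ?thesis using N by simp
    qed
    then show ?thesis by (intro tendsto_eventually) (auto simp: eventually_sequentially)
  qed
  ultimately show thesis by (rule that)
qed

text \<open>The functional acts on plain functions and its axioms are relative to the set \<open>bcontfun\<close>, so that
pointwise operations such as \<open>min\<close> and \<open>max\<close> can be written directly.\<close>

locale daniell_functional =
  fixes I :: "('a::metric_space \<Rightarrow> real) \<Rightarrow> real"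
  assumes I_add: "\<lbrakk>f \<in> bcontfun; g \<in> bcontfun\<rbrakk> \<Longrightarrow> I (\<lambda>x. f x + g x) = I f + I g"
    and I_cmult: "f \<in> bcontfun \<Longrightarrow> I (\<lambda>x. c * f x) = c * I f"
    and I_mono: "\<lbrakk>f \<in> bcontfun; g \<in> bcontfun; \<And>x. f x \<le> g x\<rbrakk> \<Longrightarrow> I f \<le> I g"
    and I_one: "I (\<lambda>x. 1) = 1"
    and I_decseq: "\<lbrakk>\<And>n::nat. F n \<in> bcontfun; \<And>x. decseq (\<lambda>n. F n x); \<And>x. (\<lambda>n. F n x) \<longlonglongrightarrow> 0\<rbrakk>
      \<Longrightarrow> (\<lambda>n. I (F n)) \<longlonglongrightarrow> 0"
begin

lemma I_const: "I (\<lambda>x. c) = c"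
  using I_cmult[OF const_bcontfun, of c 1] I_one by simp

lemma I_sum:
  assumes "\<And>k. k \<in> K \<Longrightarrow> f k \<in> bcontfun"
  shows "I (\<lambda>x. \<Sum>k\<in>K. f k x) = (\<Sum>k\<in>K. I (f k))"
  using assms
proof (induction K rule: infinite_finite_induct)
  case (insert k K)
  then show ?case using I_add[of "f k" "\<lambda>x. \<Sum>k\<in>K. f k x"] bcontfun_sum[of K f] by simp
qed (simp_all add: I_const)

lemma I_nonneg: "f \<in> subfunctions U \<Longrightarrow> 0 \<le> I f"
  using I_mono[OF const_bcontfun, of f 0] by (simp add: I_const subfunctionsD)

definition inner_content :: "'a set \<Rightarrow> ennreal" where
  "inner_content U = (SUP f\<in>subfunctions U. ennreal (I f))"

lemma I_le_inner_content: "f \<in> subfunctions U \<Longrightarrow> ennreal (I f) \<le> inner_content U"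
  unfolding inner_content_def by (rule SUP_upper)

lemma inner_content_mono: "U \<subseteq> V \<Longrightarrow> inner_content U \<le> inner_content V"
  unfolding inner_content_def by (intro SUP_subset_mono subfunctions_mono) auto

lemma inner_content_empty: "inner_content {} = 0"
proof -
  have "f = (\<lambda>x. 0)" if "f \<in> subfunctions {}" for f :: "'a \<Rightarrow> real"
    using subfunctionsD(4)[OF that] by auto
  then have "ennreal (I f) \<le> 0" if "f \<in> subfunctions {}" for f
    using that I_const[of 0] by fastforce
  then show ?thesis unfolding inner_content_def by (intro order_antisym SUP_least) auto
qed

lemma inner_content_UNIV: "inner_content UNIV = 1"
proof (rule order_antisym)
  have "I f \<le> 1" if "f \<in> subfunctions UNIV" for f
    using I_mono[OF _ const_bcontfun, of f 1] subfunctionsD[OF that] by (simp add: I_const)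
  then show "inner_content UNIV \<le> 1"
    unfolding inner_content_def by (intro SUP_least) (auto simp: ennreal_le_1)
  have "(\<lambda>x. 1) \<in> subfunctions UNIV" by (intro subfunctionsI const_bcontfun) auto
  from I_le_inner_content[OF this] show "1 \<le> inner_content UNIV" by (simp add: I_one)
qed

text \<open>The continuity axiom enters here. Let \<open>f\<close> live on the union and let
\<open>h n k\<close> increase in \<open>k\<close> to the indicator of \<open>U n\<close>. The remainders
\<open>max 0 (f - (\<Sum>n<k. h n k))\<close> are continuous and decrease to zero pointwise, so
\<open>I f\<close> is at most the sum of the \<open>I (h n k)\<close> up to a vanishing error.\<close>

lemma inner_content_countably_subadditive:
  assumes "\<And>n::nat. open (U n)"
  shows "inner_content (\<Union>n. U n) \<le> (\<Sum>n. inner_content (U n))"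
  unfolding inner_content_def[of "\<Union>n. U n"]
proof (rule SUP_least)
  fix f assume f: "f \<in> subfunctions (\<Union>n. U n)"
  have "\<exists>h. (\<forall>k. h k \<in> subfunctions (U n)) \<and> (\<forall>x. incseq (\<lambda>k. h k x)) \<and>
      (\<forall>x\<in>U n. (\<lambda>k. h k x) \<longlonglongrightarrow> 1)" for n
    using open_indicator_incseq_limit[OF assms[of n]] by metis
  then obtain h :: "nat \<Rightarrow> nat \<Rightarrow> 'a \<Rightarrow> real" where h: "\<And>n k. h n k \<in> subfunctions (U n)"
    "\<And>n x. incseq (\<lambda>k. h n k x)" "\<And>n x. x \<in> U n \<Longrightarrow> (\<lambda>k. h n k x) \<longlonglongrightarrow> 1"
    by metis
  note hb = subfunctionsD(1)[OF h(1)] and h0 = subfunctionsD(2)[OF h(1)]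
    and fb = subfunctionsD(1)[OF f]
  let ?s = "\<lambda>k x. \<Sum>n<k. h n k x"
  let ?r = "\<lambda>k x. max 0 (f x - ?s k x)"
  have sb: "?s k \<in> bcontfun" for k by (intro bcontfun_sum hb)
  have rb: "?r k \<in> bcontfun" for k by (intro bcontfun_max bcontfun_diff const_bcontfun fb sb)
  have "(\<lambda>k. I (?r k)) \<longlonglongrightarrow> 0"
  proof (rule I_decseq[OF rb])
    fix x
    have "?s k x \<le> ?s (Suc k) x" for k
    proof -
      have "?s k x \<le> (\<Sum>n<k. h n (Suc k) x)"
        using h(2) by (intro sum_mono) (auto simp: incseq_Suc_iff)
      then show ?thesis using h0[of k "Suc k" x] by simp
    qed
    then have "?r (Suc k) x \<le> ?r k x" for k
      by (intro max.mono diff_left_mono order_refl)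
    then show "decseq (\<lambda>k. ?r k x)" by (rule decseq_SucI)
    show "(\<lambda>k. ?r k x) \<longlonglongrightarrow> 0"
    proof (cases "x \<in> (\<Union>n. U n)")
      case False
      then have "?r k x = 0" for k
        using subfunctionsD(4)[OF f False] sum_nonneg[of "{..<k}" "\<lambda>n. h n k x"] h0 by simp
      then show ?thesis by simp
    next
      case True
      then obtain m where m: "x \<in> U m" by blast
      have "?r k x \<le> 1 - h m k x" if "k > m" for k
      proof -
        have "h m k x \<le> ?s k x" using that h0 by (intro member_le_sum) auto
        then show ?thesis using subfunctionsD(3)[OF f, of x] subfunctionsD(3)[OF h(1)[of m k], of x] by simp
      qed
      then have "eventually (\<lambda>k. ?r k x \<le> 1 - h m k x) sequentially"
        by (auto simp: eventually_at_top_dense)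
      moreover have "(\<lambda>k. 1 - h m k x) \<longlonglongrightarrow> 0"
        using tendsto_diff[OF tendsto_const h(3)[OF m], of 1] by simp
      ultimately show ?thesis
        by (intro tendsto_sandwich[of "\<lambda>_. 0" "\<lambda>k. ?r k x" sequentially "\<lambda>k. 1 - h m k x"]) auto
    qed
  qed
  then have "(\<lambda>k. ennreal (I (?r k))) \<longlonglongrightarrow> 0"
    using tendsto_ennrealI by fastforce
  then have "(\<lambda>k. ennreal (I (?r k)) + (\<Sum>n. inner_content (U n))) \<longlonglongrightarrow> 0 + (\<Sum>n. inner_content (U n))"
    by (intro tendsto_add tendsto_const)
  then have lim: "(\<lambda>k. ennreal (I (?r k)) + (\<Sum>n. inner_content (U n))) \<longlonglongrightarrow> (\<Sum>n. inner_content (U n))"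
    by simp
  have "ennreal (I f) \<le> ennreal (I (?r k)) + (\<Sum>n. inner_content (U n))" for k
  proof -
    have r0: "0 \<le> I (?r k)" using I_mono[OF const_bcontfun rb, of 0 k] by (simp add: I_const)
    have h0': "0 \<le> I (h n k)" for n by (rule I_nonneg[OF h(1)])
    have "I f \<le> I (\<lambda>x. ?r k x + ?s k x)"
      by (intro I_mono fb bcontfun_add rb sb) simp
    also have "\<dots> = I (?r k) + (\<Sum>n<k. I (h n k))"
      using I_add[OF rb sb] by (simp add: I_sum hb)
    finally have "ennreal (I f) \<le> ennreal (I (?r k)) + (\<Sum>n<k. ennreal (I (h n k)))"
      using r0 h0' by (simp add: sum_ennreal sum_nonneg flip: ennreal_plus)
    also have "(\<Sum>n<k. ennreal (I (h n k))) \<le> (\<Sum>n<k. inner_content (U n))"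
      by (intro sum_mono I_le_inner_content h(1))
    also have "\<dots> \<le> (\<Sum>n. inner_content (U n))"
      by (rule sum_le_suminf) auto
    finally show ?thesis by (simp add: add_left_mono)
  qed
  then show "ennreal (I f) \<le> (\<Sum>n. inner_content (U n))"
    by (intro LIMSEQ_le_const[OF lim]) auto
qed

definition outer :: "'a set \<Rightarrow> ennreal" where
  "outer A = (INF U\<in>{U. open U \<and> A \<subseteq> U}. inner_content U)"

lemma outer_open: "open U \<Longrightarrow> outer U = inner_content U"
  unfolding outer_def by (intro order_antisym INF_lower INF_greatest inner_content_mono) auto

lemma outer_mono: "A \<subseteq> B \<Longrightarrow> outer A \<le> outer B"
  unfolding outer_def by (intro INF_superset_mono) auto

text \<open>Cover each \<open>A n\<close> by an open set whose content is within \<open>e / 2^(n+1)\<close> of the optimum.\<close>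

lemma outer_countably_subadditive:
  fixes A :: "nat \<Rightarrow> 'a set"
  shows "outer (\<Union>n. A n) \<le> (\<Sum>n. outer (A n))"
proof (rule ennreal_le_epsilon)
  fix e :: real assume fin: "(\<Sum>n. outer (A n)) < top" and "0 < e"
  have "\<exists>U. open U \<and> A n \<subseteq> U \<and> inner_content U < outer (A n) + ennreal (e * (1/2)^Suc n)" for n
  proof -
    have "outer (A n) < outer (A n) + ennreal (e * (1/2)^Suc n)"
      using \<open>0 < e\<close> ennreal_suminf_lessD[OF fin, of n] by (auto simp: less_top)
    then show ?thesis unfolding outer_def[of "A n"] INF_less_iff by auto
  qed
  then obtain U where U: "\<And>n. open (U n)" "\<And>n. A n \<subseteq> U n"
    "\<And>n. inner_content (U n) < outer (A n) + ennreal (e * (1/2)^Suc n)" by metis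
  have "outer (\<Union>n. A n) \<le> inner_content (\<Union>n. U n)"
    using U unfolding outer_def by (intro INF_lower) blast
  also have "\<dots> \<le> (\<Sum>n. inner_content (U n))"
    using U(1) by (rule inner_content_countably_subadditive)
  also have "\<dots> \<le> (\<Sum>n. outer (A n) + ennreal (e * (1/2)^Suc n))"
    using U(3) by (intro suminf_le) (auto intro: less_imp_le)
  also have "\<dots> = (\<Sum>n. outer (A n)) + (\<Sum>n. ennreal e * ennreal ((1/2) ^ Suc n))"
    using \<open>0 < e\<close> by (subst suminf_add[symmetric])
      (auto simp del: ennreal_suminf_cmult simp add: ennreal_mult[symmetric])
  also have "\<dots> = (\<Sum>n. outer (A n)) + e"
    unfolding ennreal_suminf_cmult
    by (subst suminf_ennreal_eq[OF zero_le_power power_half_series]) auto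
  finally show "outer (\<Union>n. A n) \<le> (\<Sum>n. outer (A n)) + e" .
qed

lemma outer_measure_space_outer: "outer_measure_space UNIV outer"
  unfolding outer_measure_space_def positive_def increasing_def countably_subadditive_def
  using outer_open[of "{}"] inner_content_empty
  by (auto intro: outer_mono outer_countably_subadditive)

text \<open>Given \<open>f\<close> supported in \<open>U \<inter> V\<close>, the open set \<open>V \<inter> {f < e}\<close> contains
\<open>V - U\<close>. A function \<open>g\<close> supported there does not overlap with the truncation
\<open>max 0 (f - e)\<close>, so the sum of the two still lies below the indicator of \<open>V\<close>; the truncation
costs at most \<open>e\<close>.\<close>

lemma outer_split_open:
  assumes "open U" "open V"
  shows "outer (U \<inter> V) + outer (V - U) \<le> inner_content V"
proof -
  have key: "ennreal (I f) + outer (V - U) \<le> inner_content V" if f: "f \<in> subfunctions (U \<inter> V)" for f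
  proof (rule ennreal_le_epsilon)
    fix e :: real assume "0 < e"
    note fD = subfunctionsD[OF f]
    let ?W = "V \<inter> {x. f x < e}" and ?f = "\<lambda>x. max 0 (f x - e)"
    have fb: "?f \<in> bcontfun" by (intro bcontfun_max bcontfun_diff const_bcontfun fD(1))
    have "open ?W"
      using \<open>open V\<close> fD(1) by (intro open_Int open_Collect_less) (auto simp: bcontfun_def)
    moreover have "V - U \<subseteq> ?W" using fD(4) \<open>0 < e\<close> by auto
    ultimately have "outer (V - U) \<le> inner_content ?W"
      unfolding outer_def by (intro INF_lower) auto
    then have "ennreal (I f) + outer (V - U) \<le> ennreal (I f) + inner_content ?W"
      by (rule add_left_mono)
    also have "\<dots> = (SUP g\<in>subfunctions ?W. ennreal (I f) + ennreal (I g))"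
      unfolding inner_content_def using zero_in_subfunctions by (intro ennreal_SUP_add_right) auto
    also have "\<dots> \<le> inner_content V + ennreal e"
    proof (rule SUP_least)
      fix g assume g: "g \<in> subfunctions ?W"
      note gD = subfunctionsD[OF g]
      have fg: "(\<lambda>x. ?f x + g x) \<in> subfunctions V"
      proof (rule subfunctionsI)
        show "(\<lambda>x. ?f x + g x) \<in> bcontfun" by (intro bcontfun_add fb gD(1))
        show "0 \<le> ?f x + g x" for x using gD(2)[of x] by simp
        show "?f x + g x \<le> 1" for x
          using gD(3,4)[of x] fD(3)[of x] \<open>0 < e\<close> by (cases "x \<in> ?W") auto
        show "?f x + g x \<le> 0" if "x \<notin> V" for x
          using gD(4)[of x] fD(4)[of x] that \<open>0 < e\<close> by auto
      qed
      have "I f \<le> I (\<lambda>x. ?f x + e)"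
        by (intro I_mono fD(1) bcontfun_add fb const_bcontfun) auto
      also have "\<dots> = I ?f + e"
        using I_add[OF fb const_bcontfun, of e] by (simp add: I_const)
      finally have "I f + I g \<le> I (\<lambda>x. ?f x + g x) + e"
        using I_add[OF fb gD(1)] by simp
      then have "ennreal (I f) + ennreal (I g) \<le> ennreal (I (\<lambda>x. ?f x + g x)) + ennreal e"
        using I_nonneg[OF f] I_nonneg[OF g] I_nonneg[OF fg] \<open>0 < e\<close> by (simp flip: ennreal_plus)
      also have "\<dots> \<le> inner_content V + ennreal e"
        by (intro add_right_mono I_le_inner_content fg)
      finally show "ennreal (I f) + ennreal (I g) \<le> inner_content V + ennreal e" .
    qed
    finally show "ennreal (I f) + outer (V - U) \<le> inner_content V + ennreal e" .
  qed
  have "outer (U \<inter> V) + outer (V - U) = (SUP f\<in>subfunctions (U \<inter> V). ennreal (I f) + outer (V - U))"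
    unfolding outer_open[OF open_Int[OF assms]] inner_content_def
    using zero_in_subfunctions by (intro ennreal_SUP_add_left[symmetric]) auto
  also have "\<dots> \<le> inner_content V" using key by (rule SUP_least)
  finally show ?thesis .
qed

text \<open>Caratheodory's measurability condition for open sets; the test sets can be enlarged to open ones, where
the preceding inequality applies.\<close>

lemma open_in_lambda_system:
  assumes "open U"
  shows "U \<in> lambda_system UNIV UNIV outer"
proof -
  have "outer (U \<inter> A) + outer ((UNIV - U) \<inter> A) = outer A" for A
  proof (rule order_antisym)
    show "outer (U \<inter> A) + outer ((UNIV - U) \<inter> A) \<le> outer A"
      unfolding outer_def[of A]
    proof (rule INF_greatest)
      fix V assume V: "V \<in> {V. open V \<and> A \<subseteq> V}"
      then have "outer (U \<inter> A) + outer ((UNIV - U) \<inter> A) \<le> outer (U \<inter> V) + outer (V - U)"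
        by (intro add_mono outer_mono) auto
      also have "\<dots> \<le> inner_content V" using outer_split_open[OF assms] V by auto
      finally show "outer (U \<inter> A) + outer ((UNIV - U) \<inter> A) \<le> inner_content V" .
    qed
    interpret UN: sigma_algebra "UNIV :: 'a set" UNIV using sigma_algebra_Pow[of UNIV] by simp
    have "subadditive UNIV outer"
      using outer_measure_space_outer unfolding outer_measure_space_def
      by (intro UN.countably_subadditive_subadditive) auto
    then have "outer ((U \<inter> A) \<union> ((UNIV - U) \<inter> A)) \<le> outer (U \<inter> A) + outer ((UNIV - U) \<inter> A)"
      by (rule subadditiveD) auto
    then show "outer A \<le> outer (U \<inter> A) + outer ((UNIV - U) \<inter> A)"
      by (simp flip: Int_Un_distrib2)
  qed
  then show ?thesis unfolding lambda_system_def by simp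
qed

definition daniell_measure :: "'a measure" where
  "daniell_measure = measure_of UNIV (sets borel) outer"

lemma sets_daniell_measure: "sets daniell_measure = sets borel"
  and space_daniell_measure: "space daniell_measure = UNIV"
  unfolding daniell_measure_def
  by (simp_all add: sets.sets_measure_of_eq[of borel, simplified] space_measure_of_conv)

text \<open>The sets satisfying Caratheodory's condition form a sigma-algebra that contains the open sets, hence
all Borel sets, and the outer measure is a measure on it.\<close>

lemma emeasure_daniell_open:
  assumes "open U"
  shows "emeasure daniell_measure U = inner_content U"
proof -
  interpret UN: sigma_algebra "UNIV :: 'a set" UNIV using sigma_algebra_Pow[of UNIV] by simp
  let ?L = "lambda_system UNIV UNIV outer"
  have L: "measure_space UNIV ?L outer"
    by (rule UN.caratheodory_lemma[OF outer_measure_space_outer])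
  then interpret L: sigma_algebra UNIV ?L by (simp add: measure_space_def)
  have sub: "sets borel \<subseteq> ?L"
    unfolding borel_def sets_measure_of[OF subset_UNIV[of "Collect open", folded Pow_UNIV]]
    by (rule L.sigma_sets_subset) (auto intro: open_in_lambda_system)
  have "measure_space UNIV (sets borel) outer"
    using measure_down[OF L _ sub] sets.sigma_algebra_axioms[of borel] by simp
  then have "emeasure daniell_measure U = outer U"
    unfolding daniell_measure_def using assms
    by (intro emeasure_measure_of_sigma) (auto simp: measure_space_def)
  then show ?thesis using outer_open[OF assms] by simp
qed

lemma daniell_measure_prob: "daniell_measure \<in> borel_prob_measures"
  unfolding borel_prob_measures_def
  using emeasure_daniell_open[of UNIV] inner_content_UNIV
  by (auto intro!: prob_spaceI simp: sets_daniell_measure space_daniell_measure)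

lemma I_le_daniell_measure_open:
  assumes "open U" "f \<in> subfunctions U"
  shows "I f \<le> measure daniell_measure U"
proof -
  interpret prob_space daniell_measure
    using daniell_measure_prob by (simp add: borel_prob_measures_def)
  have "ennreal (I f) \<le> ennreal (measure daniell_measure U)"
    using I_le_inner_content[OF assms(2)]
    unfolding emeasure_daniell_open[OF assms(1), symmetric] emeasure_eq_measure .
  then show ?thesis by (simp add: ennreal_le_iff)
qed

text \<open>Cut \<open>f\<close> into \<open>n\<close> horizontal slices. A slice, multiplied by \<open>n\<close>, lies below the
indicator of the open set where \<open>f > k/n\<close>, so its functional is bounded by the measure of that set;
summing up gives the integral of \<open>f\<close> up to \<open>1/n\<close>.\<close>

lemma I_le_integral_unit:
  assumes f: "f \<in> bcontfun" "\<And>x. 0 \<le> f x" "\<And>x. f x \<le> 1"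
  shows "I f \<le> (\<integral>x. f x \<partial>daniell_measure)"
proof (rule field_le_epsilon)
  fix e :: real assume "0 < e"
  then obtain m where m: "inverse (real (Suc m)) < e" using reals_Archimedean by blast
  define n where "n = Suc m"
  have n: "n > 0" "1 / n < e" using m by (auto simp: n_def field_simps)
  let ?f = "\<lambda>k x. min (1 / n) (max 0 (f x - real k / n))"
  have fb: "?f k \<in> bcontfun" for k
    by (intro bcontfun_min bcontfun_max bcontfun_diff const_bcontfun f(1))
  have layer: "I (?f k) \<le> measure daniell_measure {x. k / n < f x} / n" for k
  proof -
    have "n * I (?f k) = I (\<lambda>x. n * ?f k x)" by (rule I_cmult[OF fb, symmetric])
    also have "\<dots> \<le> measure daniell_measure {x. k / n < f x}"
    proof (rule I_le_daniell_measure_open)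
      show "open {x. k / n < f x}"
        using f(1) by (intro open_Collect_less) (auto simp: bcontfun_def)
      show "(\<lambda>x. n * ?f k x) \<in> subfunctions {x. k / n < f x}"
      proof (rule subfunctionsI)
        show "(\<lambda>x. n * ?f k x) \<in> bcontfun" by (rule bcontfun_cmult[OF fb])
        show "0 \<le> n * ?f k x" for x by simp
        have "n * ?f k x \<le> n * (1 / n)" for x by (intro mult_left_mono) auto
        then show "n * ?f k x \<le> 1" for x using n(1) by simp
        show "n * ?f k x \<le> 0" if "x \<notin> {x. k / n < f x}" for x using that by (simp add: max_def)
      qed
    qed
    finally show ?thesis using n(1) by (simp add: field_simps)
  qed
  have "f x = (\<Sum>k<n. ?f k x)" for x
    using sum_clamped_layers[OF n(1) f(2)[of x]] f(3)[of x] by simp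
  then have "I f = (\<Sum>k<n. I (?f k))" using I_sum[of "{..<n}" ?f] fb by simp
  also have "\<dots> \<le> (\<Sum>k<n. measure daniell_measure {x. k / n < f x} / n)"
    by (intro sum_mono layer)
  also have "\<dots> \<le> (\<integral>x. f x \<partial>daniell_measure) + 1 / n"
    by (rule integral_layers_bounds(2)[OF daniell_measure_prob f n(1)])
  finally show "I f \<le> (\<integral>x. f x \<partial>daniell_measure) + e" using n(2) by simp
qed

lemma I_le_integral:
  assumes "f \<in> bcontfun"
  shows "I f \<le> (\<integral>x. f x \<partial>daniell_measure)"
proof -
  interpret prob_space daniell_measure
    using daniell_measure_prob by (simp add: borel_prob_measures_def)
  obtain a b g where b: "b > 0" and g: "g \<in> bcontfun" "\<And>x. 0 \<le> g x" "\<And>x. g x \<le> 1"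
    and fg: "f = (\<lambda>x. b * g x + a)"
    using bcontfun_rescale[OF assms] by blast
  have "I f = b * I g + a"
    unfolding fg using I_add[OF bcontfun_cmult[OF g(1)] const_bcontfun] I_cmult[OF g(1)]
    by (simp add: I_const)
  also have "\<dots> \<le> b * (\<integral>x. g x \<partial>daniell_measure) + a"
    using I_le_integral_unit[OF g] b by simp
  also have "\<dots> = (\<integral>x. f x \<partial>daniell_measure)"
    unfolding fg using integrable_bcontfun[OF daniell_measure_prob g(1)] by (simp add: prob_space)
  finally show ?thesis .
qed

text \<open>The inequality \<open>I f \<le> \<integral>f\<close> for all \<open>f\<close> is already enough: applied to
\<open>- f\<close> it gives the converse.\<close>

theorem I_eq_integral:
  assumes "f \<in> bcontfun"
  shows "I f = (\<integral>x. f x \<partial>daniell_measure)"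
proof (rule order_antisym)
  show "I f \<le> (\<integral>x. f x \<partial>daniell_measure)" by (rule I_le_integral[OF assms])
  have "- I f \<le> - (\<integral>x. f x \<partial>daniell_measure)"
    using I_le_integral[OF bcontfun_cmult[OF assms, of "-1"]] I_cmult[OF assms, of "-1"] by simp
  then show "(\<integral>x. f x \<partial>daniell_measure) \<le> I f" by simp
qed

end

section \<open>Subgradients of Varadhan functionals\<close>

lemma bcontfun_lift:
  assumes "f \<in> bcontfun"
  shows "apply_bcontfun (Bcontfun f) = f"
  using assms by (rule Bcontfun_inverse)

lemma convex_shift:
  fixes L :: "'v::real_vector \<Rightarrow> real"
  assumes "convex_on UNIV L"
  shows "convex_on UNIV (\<lambda>x. L (a + x) - c)"
  unfolding convex_on_def
proof (intro conjI ballI allI impI convex_UNIV)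
  fix x y and u v :: real assume uv: "0 \<le> u" "0 \<le> v" "u + v = 1"
  have v: "v = 1 - u" using uv by simp
  have "a + (u *\<^sub>R x + v *\<^sub>R y) = u *\<^sub>R (a + x) + v *\<^sub>R (a + y)"
    by (simp add: v algebra_simps)
  then have "L (a + (u *\<^sub>R x + v *\<^sub>R y)) \<le> u * L (a + x) + v * L (a + y)"
    using convex_onE[OF assms uv] by metis
  then show "L (a + (u *\<^sub>R x + v *\<^sub>R y)) - c \<le> u * (L (a + x) - c) + v * (L (a + y) - c)"
    by (simp add: v algebra_simps)
qed

text \<open>Sigma-continuity of \<open>L\<close> at the origin controls the subgradient at an arbitrary point \<open>F\<close>:
the displacement \<open>k G\<^sub>n - F\<close> leads from \<open>F\<close> to \<open>k G\<^sub>n\<close>, where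
\<open>L\<close> is close to \<open>L 0\<close>, and a large factor \<open>k\<close> makes the fixed cost of that
displacement negligible.\<close>

lemma subgradient_tends_to_zero:
  fixes L :: "('a::topological_space \<Rightarrow>\<^sub>C real) \<Rightarrow> real"
  assumes sig: "sigma_continuous L" and lin: "linear l"
    and sub: "\<And>G. l G \<le> L (F + G) - L F"
    and pos: "\<And>G. (\<And>x. 0 \<le> apply_bcontfun G x) \<Longrightarrow> 0 \<le> l G"
    and dec: "\<And>x. decseq (\<lambda>n. apply_bcontfun (G n) x)"
    and lim: "\<And>x. (\<lambda>n. apply_bcontfun (G n) x) \<longlonglongrightarrow> 0"
  shows "(\<lambda>n. l (G n)) \<longlonglongrightarrow> 0"
proof -
  have nonneg: "0 \<le> l (G n)" for n
    using decseq_ge[OF dec lim] by (intro pos)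
  have "eventually (\<lambda>n. l (G n) < e) sequentially" if "e > 0" for e
  proof -
    \<comment> \<open>C is the limit of the bound on k * l (G n); the choice of k makes (C + 1) / k equal to e\<close>
    define C where "C = L 0 - L F + l F"
    have "0 \<le> C" using sub[of "- F"] by (simp add: C_def linear_neg[OF lin])
    define k where "k = (C + 1) / e"
    have "k > 0" using \<open>0 \<le> C\<close> \<open>e > 0\<close> by (simp add: k_def)
    have "(\<lambda>n. L (k *\<^sub>R G n)) \<longlonglongrightarrow> L 0"
    proof (rule sig[unfolded sigma_continuous_def, rule_format], intro conjI)
      show "decseq (\<lambda>n. apply_bcontfun (k *\<^sub>R G n) x)" for x
        using dec[of x] \<open>k > 0\<close> by (auto simp: decseq_def)
      show "(\<lambda>n. apply_bcontfun (k *\<^sub>R G n) x) \<longlonglongrightarrow> 0" for x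
        using tendsto_mult_right_zero[OF lim[of x], of k] by simp
    qed
    then have "eventually (\<lambda>n. L (k *\<^sub>R G n) < L 0 + 1) sequentially"
      by (rule order_tendstoD) simp
    then show ?thesis
    proof eventually_elim
      case (elim n)
      have "k * l (G n) - l F = l (k *\<^sub>R G n - F)"
        by (simp add: linear_diff[OF lin] linear_scale[OF lin])
      also have "\<dots> \<le> L (k *\<^sub>R G n) - L F" using sub[of "k *\<^sub>R G n - F"] by simp
      finally have "k * l (G n) < C + 1" using elim by (simp add: C_def)
      also have "\<dots> = k * e" using \<open>e > 0\<close> by (simp add: k_def)
      finally show ?case using \<open>k > 0\<close> by simp
    qed
  qed
  then show ?thesis
    using nonneg by (intro order_tendstoI) (auto intro: always_eventually less_le_trans)
qed

text \<open>Every point \<open>F\<close> has a subgradient that is integration against a probability measure. Monotonicity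
of \<open>L\<close> makes a subgradient positive. Translation by a constant \<open>c\<close> gives
\<open>l c \<le> c\<close>, and with both signs \<open>l 1 = 1\<close>, so Daniell's theorem applies.\<close>

lemma varadhan_subgradient_measure:
  fixes L :: "('a::metric_space \<Rightarrow>\<^sub>C real) \<Rightarrow> real"
  assumes var: "varadhan_functional L" and conv: "convex_on UNIV L" and sig: "sigma_continuous L"
  obtains \<mu> where "\<mu> \<in> borel_prob_measures"
    "\<And>G. (\<integral>x. apply_bcontfun G x \<partial>\<mu>) - L G \<le> (\<integral>x. apply_bcontfun F x \<partial>\<mu>) - L F"
proof -
  have Lmono: "L G \<le> L H" if "\<And>x. apply_bcontfun G x \<le> apply_bcontfun H x" for G H
    using var that unfolding varadhan_functional_def by blast
  have Lconst: "L (G + const_bcontfun c) = L G + c" for G c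
    using var unfolding varadhan_functional_def by blast
  obtain l where lin: "linear l" and sub: "\<And>G. l G \<le> L (F + G) - L F"
    using convex_imp_linear_minorant[of "\<lambda>G. L (F + G) - L F"] convex_shift[OF conv, of F "L F"]
    by auto
  have pos: "0 \<le> l G" if "\<And>x. 0 \<le> apply_bcontfun G x" for G
  proof -
    have "- l G \<le> L (F + (- G)) - L F" using sub[of "- G"] by (simp only: linear_neg[OF lin])
    also have "\<dots> \<le> 0" using Lmono[of "F + (- G)" F] that by simp
    finally show ?thesis by simp
  qed
  have "l (const_bcontfun c) \<le> c" for c using sub[of "const_bcontfun c"] Lconst by simp
  moreover have "const_bcontfun (- 1) = - const_bcontfun (1::real)"
    by (rule bcontfun_eqI) simp
  ultimately have one: "l (const_bcontfun 1) = 1"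
    using linear_neg[OF lin, of "const_bcontfun 1"] by (metis antisym neg_le_iff_le)
  interpret daniell_functional "\<lambda>f. l (Bcontfun f)"
  proof
    fix f g :: "'a \<Rightarrow> real" and c assume f: "f \<in> bcontfun"
    have "Bcontfun (\<lambda>x. c * f x) = c *\<^sub>R Bcontfun f"
      by (rule bcontfun_eqI) (simp add: bcontfun_lift bcontfun_cmult f)
    then show "l (Bcontfun (\<lambda>x. c * f x)) = c * l (Bcontfun f)" by (simp add: linear_scale[OF lin])
    assume g: "g \<in> bcontfun"
    have "Bcontfun (\<lambda>x. f x + g x) = Bcontfun f + Bcontfun g"
      by (rule bcontfun_eqI) (simp add: bcontfun_lift bcontfun_add f g)
    then show "l (Bcontfun (\<lambda>x. f x + g x)) = l (Bcontfun f) + l (Bcontfun g)"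
      by (simp add: linear_add[OF lin])
    assume "\<And>x. f x \<le> g x"
    then have "0 \<le> l (Bcontfun g - Bcontfun f)"
      by (intro pos) (simp add: bcontfun_lift f g)
    then show "l (Bcontfun f) \<le> l (Bcontfun g)" by (simp add: linear_diff[OF lin])
  next
    have "Bcontfun (\<lambda>x. 1) = (const_bcontfun 1 :: 'a \<Rightarrow>\<^sub>C real)"
      by (rule bcontfun_eqI) (simp add: bcontfun_lift const_bcontfun)
    then show "l (Bcontfun (\<lambda>x. 1)) = 1" using one by simp
  next
    fix f :: "nat \<Rightarrow> 'a \<Rightarrow> real"
    assume "\<And>n. f n \<in> bcontfun" "\<And>x. decseq (\<lambda>n. f n x)" "\<And>x. (\<lambda>n. f n x) \<longlonglongrightarrow> 0"
    then show "(\<lambda>n. l (Bcontfun (f n))) \<longlonglongrightarrow> 0"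
      by (intro subgradient_tends_to_zero[OF sig lin sub pos]) (simp_all add: bcontfun_lift)
  qed
  have l: "l G = (\<integral>x. apply_bcontfun G x \<partial>daniell_measure)" for G
    using I_eq_integral[OF apply_bcontfun, of G] by (simp add: apply_bcontfun_inverse)
  show thesis
  proof (rule that[OF daniell_measure_prob])
    fix G
    have "l G - l F \<le> L G - L F"
      using sub[of "G - F"] by (simp add: linear_diff[OF lin])
    then show "(\<integral>x. apply_bcontfun G x \<partial>daniell_measure) - L G
        \<le> (\<integral>x. apply_bcontfun F x \<partial>daniell_measure) - L F"
      unfolding l[of F, symmetric] l[of G, symmetric] by simp
  qed
qed

section \<open>The penalty and the variational formula\<close>

text \<open>The convex conjugate of \<open>L - L 0\<close>, restricted to probability measures. Truncating each term at
zero by \<open>ennreal\<close> does not change the supremum, since the term for \<open>F = 0\<close> is zero.\<close>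

definition penalty :: "(('a::topological_space \<Rightarrow>\<^sub>C real) \<Rightarrow> real) \<Rightarrow> 'a measure \<Rightarrow> ennreal" where
  "penalty L \<mu> = (SUP F. ennreal ((\<integral>x. apply_bcontfun F x \<partial>\<mu>) - (L F - L 0)))"

text \<open>If one term of the supremum exceeds \<open>c\<close> at \<open>\<mu>\<close>, the same term exceeds \<open>c\<close> on
a Prokhorov ball around \<open>\<mu>\<close>.\<close>

lemma lower_semicontinuous_penalty:
  "lower_semicontinuous_map prokhorov_topology (penalty L)"
proof -
  interpret M: Metric_space "borel_prob_measures :: 'a::metric_space measure set" prokhorov_dist
    by (rule Metric_space_prokhorov)
  have "openin M.mtopology {\<mu> \<in> borel_prob_measures. c < penalty L \<mu>}" for c
    unfolding M.openin_mtopology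
  proof (intro conjI allI impI)
    fix \<mu> :: "'a measure" assume "\<mu> \<in> {\<mu> \<in> borel_prob_measures. c < penalty L \<mu>}"
    then have mu: "\<mu> \<in> borel_prob_measures" and "c < penalty L \<mu>" by auto
    then obtain F where F: "c < ennreal ((\<integral>x. apply_bcontfun F x \<partial>\<mu>) - (L F - L 0))"
      unfolding penalty_def less_SUP_iff by auto
    then obtain d where c: "c = ennreal d" "0 \<le> d"
      by (metis ennreal_cases ennreal_less_top less_asym)
    have "d + (L F - L 0) < (\<integral>x. apply_bcontfun F x \<partial>\<mu>)"
      using F c by (simp add: ennreal_less_iff)
    from prokhorov_lsc_integral[OF mu apply_bcontfun this]
    obtain r where r: "r > 0" "\<And>\<nu>. \<nu> \<in> borel_prob_measures \<Longrightarrow> prokhorov_dist \<mu> \<nu> < r \<Longrightarrow>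
        d + (L F - L 0) < (\<integral>x. apply_bcontfun F x \<partial>\<nu>)" by blast
    have "M.mball \<mu> r \<subseteq> {\<mu> \<in> borel_prob_measures. c < penalty L \<mu>}"
    proof (intro subsetI CollectI conjI)
      fix \<nu> assume "\<nu> \<in> M.mball \<mu> r"
      then have nu: "\<nu> \<in> borel_prob_measures" "prokhorov_dist \<mu> \<nu> < r" by auto
      then show "\<nu> \<in> borel_prob_measures" by simp
      have "c < ennreal ((\<integral>x. apply_bcontfun F x \<partial>\<nu>) - (L F - L 0))"
        using r(2)[OF nu] c by (simp add: ennreal_less_iff)
      then show "c < penalty L \<nu>" unfolding penalty_def less_SUP_iff by blast
    qed
    then show "\<exists>r>0. M.mball \<mu> r \<subseteq> {\<mu> \<in> borel_prob_measures. c < penalty L \<mu>}" using r(1) by blast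
  qed auto
  then show ?thesis by (simp add: lower_semicontinuous_map_def)
qed

lemma integral_minus_penalty_le:
  "ereal (\<integral>x. apply_bcontfun F x \<partial>\<mu>) - enn2ereal (penalty L \<mu>) \<le> ereal (L F - L 0)"
proof -
  have le: "ennreal ((\<integral>x. apply_bcontfun F x \<partial>\<mu>) - (L F - L 0)) \<le> penalty L \<mu>"
    unfolding penalty_def by (rule SUP_upper) simp
  show ?thesis
  proof (cases "penalty L \<mu>" rule: ennreal_cases)
    case (real r)
    then have "(\<integral>x. apply_bcontfun F x \<partial>\<mu>) - (L F - L 0) \<le> r"
      using le by (simp add: ennreal_le_iff)
    then show ?thesis using real by (simp add: enn2ereal_ennreal)
  next
    case top
    then show ?thesis by simp
  qed
qed

theorem theorem2p2:
  fixes L :: "('a::polish_space \<Rightarrow>\<^sub>C real) \<Rightarrow> real"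
  assumes "varadhan_functional L"
    and "convex_on UNIV L"
    and "sigma_continuous L"
  shows "\<exists>(J :: 'a measure \<Rightarrow> ennreal) (L0 :: real).
           lower_semicontinuous_map prokhorov_topology J \<and>
           (\<forall>F. ereal (L F) = ereal L0 +
              (SUP \<mu>\<in>borel_prob_measures.
                 ereal (\<integral>x. apply_bcontfun F x \<partial>\<mu>) - enn2ereal (J \<mu>)))"
proof (intro exI conjI allI)
  show "lower_semicontinuous_map prokhorov_topology (penalty L)"
    by (rule lower_semicontinuous_penalty)
  fix F :: "'a \<Rightarrow>\<^sub>C real"
  let ?v = "\<lambda>\<mu>. ereal (\<integral>x. apply_bcontfun F x \<partial>\<mu>) - enn2ereal (penalty L \<mu>)"
  obtain \<mu> where mu: "\<mu> \<in> borel_prob_measures"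
    and max: "\<And>G. (\<integral>x. apply_bcontfun G x \<partial>\<mu>) - L G \<le> (\<integral>x. apply_bcontfun F x \<partial>\<mu>) - L F"
    using varadhan_subgradient_measure[OF assms, of F] by blast
  have "ereal (L F - L 0) \<le> ?v \<mu>"
  proof -
    let ?b = "(\<integral>x. apply_bcontfun F x \<partial>\<mu>) - (L F - L 0)"
    have "penalty L \<mu> \<le> ennreal ?b"
      unfolding penalty_def
    proof (rule SUP_least, rule ennreal_leI)
      show "(\<integral>x. apply_bcontfun G x \<partial>\<mu>) - (L G - L 0) \<le> ?b" for G using max[of G] by simp
    qed
    moreover have "0 \<le> ?b" using max[of 0] by simp
    ultimately have "enn2ereal (penalty L \<mu>) \<le> ereal ?b"
      by (metis enn2ereal_ennreal less_eq_ennreal.rep_eq)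
    moreover have "0 \<le> enn2ereal (penalty L \<mu>)" by simp
    ultimately show ?thesis by (cases "enn2ereal (penalty L \<mu>)") auto
  qed
  then have "(SUP \<mu>\<in>borel_prob_measures. ?v \<mu>) = ereal (L F - L 0)"
    using mu integral_minus_penalty_le[where F = F and L = L]
    by (intro order_antisym SUP_least SUP_upper2[of \<mu>]) auto
  then show "ereal (L F) = ereal (L 0) + (SUP \<mu>\<in>borel_prob_measures. ?v \<mu>)"
    by simp
qed

end
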